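(* Let $Q$ be any poset with finite downsets. Then: (i) an initial scaffold $P\subseteq Q$ exists; (ii) for every initial scaffold $P\subseteq Q$, the inclusion $P\hookrightarrow Q$ is a minimal initial functor; (iii) if $Q$ has a finite initial scaffold and $F\colon C\to Q$ is a minimal initial functor, then $F$ is an embedding and $\operatorname{im} F$ is an initial scaffold of $Q$.
   Context: A poset is regarded as a thin category whose objects are its elements and whose morphisms are its relations $p\le q$ (identities $p\le p$ included). A subposet $P\subseteq Q$ is a poset whose elements are elements of $Q$ and whose relations are relations of $Q$ (not necessarily all relations of $Q$ between elements of $P$). $Q$ has finite downsets if $\{p\in Q\mid p\le q\}$ is finite for every $q\in Q$. A minimum of $Q$ means a minimal element. A category is connected if it is nonempty and any two objects $c,c'$ are joined by a finite sequence $c=c_1,\dots,c_k=c'$ of objects such that for each $i$, $\hom(c_i,c_{i+1})$ or $\hom(c_{i+1},c_i)$ is nonempty; otherwise it is disconnected (so the empty category is disconnected). A component is a maximal connected subcategory. For $q\in Q$, $\operatorname{dn}(q)=\{p\in Q\mid p<q\}$, as a full subposet (all relations inherited). Let $I_Q=\{q\in Q\mid \operatorname{dn}(q)\text{ is disconnected}\}$ (this contains all minima). An initial scaffold of a poset $Q$ with finite downsets is a subposet $P\subseteq Q$ whose set of elements is $I_Q$ and such that, for each $p\in P$ and each component $A$ of $\operatorname{dn}(p)$, $P$ contains exactly one relation $m<p$ with $m\in A$, and this $m$ is a minimum of $Q$; $P$ has no other non-identity relations. Given a functor $F\colon C\to D$ and an object $d$ of $D$, the comma category $(F\downarrow d)$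 has as objects the pairs $(c,\gamma)$ with $c\in\operatorname{Ob}C$, $\gamma\in\hom(F(c),d)$, and as morphisms $(c,\gamma)\to(c',\gamma')$ the morphisms $\kappa\colon c\to c'$ in $C$ with $\gamma=\gamma'\circ F(\kappa)$. A functor $F\colon C\to D$ with $C,D$ small is initial if $(F\downarrow d)$ is connected for every $d\in\operatorname{Ob}D$. An initial functor $F\colon C\to D$ is minimal if for every initial functor $F'\colon C'\to D$ one has $|\operatorname{Ob}C|\le|\operatorname{Ob}C'|$ and $|\hom C|\le|\hom C'|$, where $\operatorname{Ob}C$ and $\hom C$ are the sets of all objects and of all morphisms (identities included). An embedding is a faithful functor that is injective on objects. The image of $F\colon C\to D$ is the pair $\operatorname{im}F=(F(\operatorname{Ob}C),F(\hom C))$ of a set of objects and a set of morphisms of $D$. *)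

theory Defs
  imports "HOL-Library.Equipollence"
begin

subsection \<open>Categories and functors\<close>

record ('o, 'm) cat =
  Obj :: "'o set"
  Mor :: "'m set"
  Dom :: "'m \<Rightarrow> 'o"
  Cod :: "'m \<Rightarrow> 'o"
  Ident :: "'o \<Rightarrow> 'm"
  Comp :: "'m \<Rightarrow> 'm \<Rightarrow> 'm"  \<comment> \<open>\<open>Comp C g f\<close> is \<open>g\<close> after \<open>f\<close>\<close>

definition hom :: "('o, 'm) cat \<Rightarrow> 'o \<Rightarrow> 'o \<Rightarrow> 'm set" where
  "hom C x y = {f \<in> Mor C. Dom C f = x \<and> Cod C f = y}"

locale category =
  fixes C :: "('o, 'm) cat"
  assumes Dom_in: "f \<in> Mor C \<Longrightarrow> Dom C f \<in> Obj C"
    and Cod_in: "f \<in> Mor C \<Longrightarrow> Cod C f \<in> Obj C"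
    and Ident_in: "x \<in> Obj C \<Longrightarrow> Ident C x \<in> hom C x x"
    and Comp_in: "\<lbrakk>f \<in> hom C x y; g \<in> hom C y z\<rbrakk> \<Longrightarrow> Comp C g f \<in> hom C x z"
    and Ident_left: "f \<in> hom C x y \<Longrightarrow> Comp C (Ident C y) f = f"
    and Ident_right: "f \<in> hom C x y \<Longrightarrow> Comp C f (Ident C x) = f"
    and Comp_assoc: "\<lbrakk>f \<in> hom C w x; g \<in> hom C x y; h \<in> hom C y z\<rbrakk>
      \<Longrightarrow> Comp C h (Comp C g f) = Comp C (Comp C h g) f"

record ('o, 'm, 'p, 'n) ftor =
  fobj :: "'o \<Rightarrow> 'p"
  fmor :: "'m \<Rightarrow> 'n"

locale cat_functor = C: category C + D: category D
  for C :: "('o, 'm) cat" and D :: "('p, 'n) cat" +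
  fixes F :: "('o, 'm, 'p, 'n) ftor"
  assumes fobj_in: "x \<in> Obj C \<Longrightarrow> fobj F x \<in> Obj D"
    and fmor_in: "f \<in> hom C x y \<Longrightarrow> fmor F f \<in> hom D (fobj F x) (fobj F y)"
    and fmor_Ident: "x \<in> Obj C \<Longrightarrow> fmor F (Ident C x) = Ident D (fobj F x)"
    and fmor_Comp: "\<lbrakk>f \<in> hom C x y; g \<in> hom C y z\<rbrakk>
      \<Longrightarrow> fmor F (Comp C g f) = Comp D (fmor F g) (fmor F f)"

definition faithful :: "('o, 'm) cat \<Rightarrow> ('o, 'm, 'p, 'n) ftor \<Rightarrow> bool" where
  "faithful C F \<longleftrightarrow> (\<forall>x\<in>Obj C. \<forall>y\<in>Obj C. inj_on (fmor F) (hom C x y))"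

definition embedding :: "('o, 'm) cat \<Rightarrow> ('p, 'n) cat \<Rightarrow> ('o, 'm, 'p, 'n) ftor \<Rightarrow> bool" where
  "embedding C D F \<longleftrightarrow> cat_functor C D F \<and> faithful C F \<and> inj_on (fobj F) (Obj C)"

definition functor_image :: "('o, 'm) cat \<Rightarrow> ('o, 'm, 'p, 'n) ftor \<Rightarrow> 'p set \<times> 'n set" where
  "functor_image C F = (fobj F ` Obj C, fmor F ` Mor C)"


subsection \<open>Connectedness and components\<close>

definition linked :: "('o, 'm) cat \<Rightarrow> 'o rel" where
  "linked C = {(x, y). x \<in> Obj C \<and> y \<in> Obj C \<and> (hom C x y \<noteq> {} \<or> hom C y x \<noteq> {})}"

definition connected_category :: "('o, 'm) cat \<Rightarrow> bool" where
  "connected_category C \<longleftrightarrow> Obj C \<noteq> {} \<and> (\<forall>x\<in>Obj C. \<forall>y\<in>Obj C. (x, y) \<in> (linked C)\<^sup>*)"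

text \<open>A subcategory is given by its set of objects and its set of morphisms; the remaining
  structure is inherited.\<close>

definition subcategory :: "('o, 'm) cat \<Rightarrow> 'o set \<Rightarrow> 'm set \<Rightarrow> bool" where
  "subcategory C S M \<longleftrightarrow> S \<subseteq> Obj C \<and> M \<subseteq> Mor C \<and>
     (\<forall>f\<in>M. Dom C f \<in> S \<and> Cod C f \<in> S) \<and>
     (\<forall>x\<in>S. Ident C x \<in> M) \<and>
     (\<forall>f\<in>M. \<forall>g\<in>M. Cod C f = Dom C g \<longrightarrow> Comp C g f \<in> M)"

definition connected_subcategory :: "('o, 'm) cat \<Rightarrow> 'o set \<Rightarrow> 'm set \<Rightarrow> bool" where
  "connected_subcategory C S M \<longleftrightarrow>
     subcategory C S M \<and> connected_category (C\<lparr>Obj := S, Mor := M\<rparr>)"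

definition is_component :: "('o, 'm) cat \<Rightarrow> 'o set \<Rightarrow> 'm set \<Rightarrow> bool" where
  "is_component C S M \<longleftrightarrow> connected_subcategory C S M \<and>
     (\<forall>S' M'. connected_subcategory C S' M' \<and> S \<subseteq> S' \<and> M \<subseteq> M' \<longrightarrow> S' = S \<and> M' = M)"


subsection \<open>Comma categories and (minimal) initial functors\<close>

text \<open>A morphism of \<open>(F \<down> d)\<close> is recorded together with its domain and codomain, since the same
  \<open>\<kappa>\<close> may underlie several morphisms.\<close>

definition comma :: "('o, 'm) cat \<Rightarrow> ('p, 'n) cat \<Rightarrow> ('o, 'm, 'p, 'n) ftor \<Rightarrow> 'p
    \<Rightarrow> ('o \<times> 'n, ('o \<times> 'n) \<times> 'm \<times> ('o \<times> 'n)) cat" where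
  "comma C D F d = \<lparr>
     Obj = {(c, \<gamma>). c \<in> Obj C \<and> \<gamma> \<in> hom D (fobj F c) d},
     Mor = {((c, \<gamma>), \<kappa>, (c', \<gamma>')). c \<in> Obj C \<and> c' \<in> Obj C \<and>
              \<gamma> \<in> hom D (fobj F c) d \<and> \<gamma>' \<in> hom D (fobj F c') d \<and>
              \<kappa> \<in> hom C c c' \<and> \<gamma> = Comp D \<gamma>' (fmor F \<kappa>)},
     Dom = (\<lambda>(x, \<kappa>, y). x),
     Cod = (\<lambda>(x, \<kappa>, y). y),
     Ident = (\<lambda>x. (x, Ident C (fst x), x)),
     Comp = (\<lambda>(y', \<kappa>', z) (x, \<kappa>, y). (x, Comp C \<kappa>' \<kappa>, z))\<rparr>"

definition initial_functor ::
    "('o, 'm) cat \<Rightarrow> ('p, 'n) cat \<Rightarrow> ('o, 'm, 'p, 'n) ftor \<Rightarrow> bool" where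
  "initial_functor C D F \<longleftrightarrow>
     cat_functor C D F \<and> (\<forall>d\<in>Obj D. connected_category (comma C D F d))"

text \<open>HOL formulas cannot quantify over types, so the types of objects and morphisms of the
  competing categories are parameters of minimality.\<close>

definition minimal_initial_functor ::
    "'x itself \<Rightarrow> 'y itself \<Rightarrow> ('o, 'm) cat \<Rightarrow> ('p, 'n) cat \<Rightarrow> ('o, 'm, 'p, 'n) ftor \<Rightarrow> bool" where
  "minimal_initial_functor (_ :: 'x itself) (_ :: 'y itself) C D F \<longleftrightarrow>
     initial_functor C D F \<and>
     (\<forall>(C' :: ('x, 'y) cat) F'. initial_functor C' D F' \<longrightarrow>
        Obj C \<lesssim> Obj C' \<and> Mor C \<lesssim> Mor C')"


subsection \<open>Posets and initial scaffolds\<close>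

text \<open>A poset is represented by its (reflexive) order relation \<open>Q\<close> with \<open>Partial_order Q\<close>; its set
  of elements is \<open>Field Q\<close>.\<close>

definition poset_cat :: "'a rel \<Rightarrow> ('a, 'a \<times> 'a) cat" where
  "poset_cat Q = \<lparr>Obj = Field Q, Mor = Q, Dom = fst, Cod = snd, Ident = (\<lambda>x. (x, x)),
     Comp = (\<lambda>g f. (fst f, snd g))\<rparr>"

definition poset_inclusion :: "('a, 'a \<times> 'a, 'a, 'a \<times> 'a) ftor" where
  "poset_inclusion = \<lparr>fobj = (\<lambda>x. x), fmor = (\<lambda>f. f)\<rparr>"

definition subposet :: "'a rel \<Rightarrow> 'a rel \<Rightarrow> bool" where
  "subposet P Q \<longleftrightarrow> Partial_order P \<and> Field P \<subseteq> Field Q \<and> P \<subseteq> Q"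

definition finite_downsets :: "'a rel \<Rightarrow> bool" where
  "finite_downsets Q \<longleftrightarrow> (\<forall>q\<in>Field Q. finite {p \<in> Field Q. (p, q) \<in> Q})"

text \<open>A minimum is a minimal element, not necessarily a least one.\<close>

definition is_minimum :: "'a rel \<Rightarrow> 'a \<Rightarrow> bool" where
  "is_minimum Q m \<longleftrightarrow> m \<in> Field Q \<and> (\<forall>x. (x, m) \<in> Q \<longrightarrow> x = m)"

definition dn :: "'a rel \<Rightarrow> 'a \<Rightarrow> 'a rel" where
  "dn Q q = Restr Q {p \<in> Field Q. (p, q) \<in> Q \<and> p \<noteq> q}"

definition scaffold_elements :: "'a rel \<Rightarrow> 'a set" where
  "scaffold_elements Q = {q \<in> Field Q. \<not> connected_category (poset_cat (dn Q q))}"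

definition initial_scaffold :: "'a rel \<Rightarrow> 'a rel \<Rightarrow> bool" where
  "initial_scaffold Q P \<longleftrightarrow> subposet P Q \<and> Field P = scaffold_elements Q \<and>
     (\<forall>p\<in>Field P. \<forall>S M. is_component (poset_cat (dn Q p)) S M \<longrightarrow>
        (\<exists>m. {m' \<in> S. (m', p) \<in> P \<and> m' \<noteq> p} = {m} \<and> is_minimum Q m)) \<and>
     (\<forall>m p. (m, p) \<in> P \<and> m \<noteq> p \<longrightarrow>
        (\<exists>S M. is_component (poset_cat (dn Q p)) S M \<and> m \<in> S))"

end

theory Submission
  imports Defs
begin

text \<open>
  Write \<open>dn p\<close> for the elements strictly below \<open>p\<close>; otherwise \<open>below\<close> allows equality. A functor \<open>F\<close> into \<open>Q\<close> is initial iff, for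
  every \<open>q\<close>, there are objects that \<open>F\<close> sends below \<open>q\<close> and any two of them are joined by a zigzag
  of morphisms between such objects.

  The lower bound comes from following such a zigzag. Let \<open>A\<close> be a component of \<open>dn p\<close>. Some object
  lies over \<open>A\<close>, because initiality gives an object below any element of \<open>A\<close>. A zigzag below \<open>p\<close> from
  this object to one that is not over \<open>A\<close> can leave \<open>A\<close> only through a morphism whose image is a
  relation \<open>y < p\<close> with \<open>y \<in> A\<close>. Suppose that \<open>dn p\<close> is disconnected. If it is empty, an object below
  \<open>p\<close> lies over \<open>p\<close>. Otherwise there is an object over a second component, so \<open>A\<close> is left and again
  \<open>p\<close> is hit by \<open>F\<close>. With an object over \<open>p\<close> as the target, every component is left in this way
  (\<open>initial_lifts_relation\<close>). A scaffold has, besides the identity, one relation to \<open>p\<close> per component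
  of \<open>dn p\<close>, so its relations inject into the morphisms of every initial functor
  (\<open>scaffold_lift\<close>).

  Conversely a scaffold \<open>P\<close> is initial, by induction along \<open>Q\<close>: neighbouring elements of
  a zigzag in \<open>dn q\<close> have common scaffold elements below them, so every zigzag in \<open>dn q\<close> can be
  replaced by one in \<open>P\<close>, and when \<open>q\<close> itself belongs to \<open>P\<close> the relations of \<open>P\<close> tie the components
  of \<open>dn q\<close> together (\<open>scaffold_connected_below\<close>).

  If \<open>P\<close> is finite and \<open>F\<close> is minimal, the injections above are bijections, so \<open>F\<close> is an embedding
  whose image has one relation to \<open>p\<close> per component of \<open>dn p\<close>. The source \<open>x\<close> of such a relation
  must be minimal: otherwise the image contains some \<open>y < x\<close>, hence by composition \<open>y < p\<close>, a second
  relation from the same component (\<open>minimal_initial_image_scaffold\<close>).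
\<close>

section \<open>Zigzags and components\<close>

definition zigzag :: "'a rel \<Rightarrow> 'a rel" where
  "zigzag R = (R \<union> R\<inverse>)\<^sup>*"

lemma zigzag_refl [simp]: "(x, x) \<in> zigzag R"
  by (simp add: zigzag_def)

lemma zigzag_sym: "(x, y) \<in> zigzag R \<Longrightarrow> (y, x) \<in> zigzag R"
  unfolding zigzag_def by (meson sym_Un_converse sym_rtrancl symD)

lemma zigzag_trans: "(x, y) \<in> zigzag R \<Longrightarrow> (y, z) \<in> zigzag R \<Longrightarrow> (x, z) \<in> zigzag R"
  unfolding zigzag_def by (rule rtrancl_trans)

lemma zigzag_step: "(x, y) \<in> R \<Longrightarrow> (x, y) \<in> zigzag R"
  unfolding zigzag_def by auto

lemma zigzag_mono: "R \<subseteq> S \<Longrightarrow> zigzag R \<subseteq> zigzag S"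
  unfolding zigzag_def by (rule rtrancl_mono) auto

lemma zigzag_Field: "(x, y) \<in> zigzag R \<Longrightarrow> x \<in> Field R \<Longrightarrow> y \<in> Field R"
  unfolding zigzag_def by (induction rule: rtrancl_induct) (auto simp: Field_def)

lemma hom_poset_cat: "hom (poset_cat R) x y = (if (x, y) \<in> R then {(x, y)} else {})"
  by (auto simp: hom_def poset_cat_def)

lemma poset_cat_sel [simp]:
  "Obj (poset_cat R) = Field R" "Mor (poset_cat R) = R"
  "Dom (poset_cat R) = fst" "Cod (poset_cat R) = snd"
  "Ident (poset_cat R) = (\<lambda>x. (x, x))"
  "Comp (poset_cat R) = (\<lambda>g f. (fst f, snd g))"
  by (simp_all add: poset_cat_def)

lemma linked_poset_cat: "linked (poset_cat R) = R \<union> R\<inverse>"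
  by (auto simp: linked_def hom_poset_cat Field_def split: if_splits)

lemma connected_poset_cat:
  "connected_category (poset_cat R) \<longleftrightarrow>
     Field R \<noteq> {} \<and> (\<forall>x\<in>Field R. \<forall>y\<in>Field R. (x, y) \<in> zigzag R)"
  by (simp add: connected_category_def linked_poset_cat zigzag_def)

lemma category_poset_cat:
  assumes "Partial_order R"
  shows "category (poset_cat R)"
proof
  show "Comp (poset_cat R) g f \<in> hom (poset_cat R) x z"
    if "f \<in> hom (poset_cat R) x y" "g \<in> hom (poset_cat R) y z" for f g x y z
    using that assms
    by (auto simp: hom_poset_cat order_on_defs split: if_splits dest: transD)
  show "Ident (poset_cat R) x \<in> hom (poset_cat R) x x" if "x \<in> Obj (poset_cat R)" for x
    using that assms by (auto simp: hom_def order_on_defs refl_on_def)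
qed (auto simp: hom_poset_cat Field_def split: if_splits)

lemma subcategory_poset_cat:
  assumes "subcategory (poset_cat R) S M"
  shows "M \<subseteq> R" and "Field M = S" and "(poset_cat R)\<lparr>Obj := S, Mor := M\<rparr> = poset_cat M"
proof -
  show "M \<subseteq> R" using assms by (auto simp: subcategory_def)
  show F: "Field M = S"
    using assms by (fastforce simp: subcategory_def Field_def)
  then show "(poset_cat R)\<lparr>Obj := S, Mor := M\<rparr> = poset_cat M"
    by (simp add: poset_cat_def)
qed

text \<open>A zigzag that starts in a zigzag class never leaves it, so the class is connected as a full
  subposet.\<close>

lemma zigzag_class_connected:
  assumes R: "Partial_order R" and x: "x \<in> Field R"
  defines "S \<equiv> zigzag R `` {x}"
  shows "connected_subcategory (poset_cat R) S (Restr R S)"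
proof -
  have SF: "S \<subseteq> Field R" using zigzag_Field x by (fastforce simp: S_def)
  have refl: "(y, y) \<in> R" if "y \<in> S" for y
    using that SF R by (auto simp: order_on_defs refl_on_def)
  have sub: "subcategory (poset_cat R) S (Restr R S)"
    using SF refl R
    by (auto simp: subcategory_def order_on_defs dest: transD)
  have reach: "(x, y) \<in> zigzag (Restr R S)" if "y \<in> S" for y
  proof -
    have "(x, y) \<in> (R \<union> R\<inverse>)\<^sup>*" using that by (simp add: S_def zigzag_def)
    then show ?thesis
    proof (induction rule: rtrancl_induct)
      case base
      show ?case by simp
    next
      case (step y z)
      have "y \<in> S" "z \<in> S"
        using step.hyps by (auto simp: S_def zigzag_def intro: rtrancl_into_rtrancl)
      then have "(y, z) \<in> zigzag (Restr R S)"
        using step.hyps(2) by (auto intro: zigzag_step zigzag_sym)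
      with step.IH show ?case by (rule zigzag_trans)
    qed
  qed
  have "x \<in> S" by (simp add: S_def)
  then show ?thesis
    unfolding connected_subcategory_def subcategory_poset_cat(3)[OF sub] connected_poset_cat
      subcategory_poset_cat(2)[OF sub]
    using sub reach by (blast intro: zigzag_sym zigzag_trans)
qed

lemma connected_subcategory_poset_cat:
  assumes "connected_subcategory (poset_cat R) S M"
  shows "S \<noteq> {}" and "S \<subseteq> Field R" and "M \<subseteq> Restr R S"
    and "\<And>x. x \<in> S \<Longrightarrow> S \<subseteq> zigzag R `` {x}"
proof -
  have sub: "subcategory (poset_cat R) S M"
    using assms by (simp add: connected_subcategory_def)
  have con: "connected_category (poset_cat M)"
    using assms subcategory_poset_cat(3)[OF sub] by (simp add: connected_subcategory_def)
  note M = subcategory_poset_cat(1,2)[OF sub]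
  show "S \<noteq> {}" "M \<subseteq> Restr R S" "S \<subseteq> Field R"
    using con M by (auto simp: connected_poset_cat Field_def)
  show "S \<subseteq> zigzag R `` {x}" if "x \<in> S" for x
    using con M(2) zigzag_mono[OF M(1)] that by (auto simp: connected_poset_cat)
qed

text \<open>A component is maximal in its morphisms too, so it carries all relations between its elements.\<close>

lemma component_iff_zigzag_class:
  assumes R: "Partial_order R"
  shows "is_component (poset_cat R) S M \<longleftrightarrow>
    (\<exists>x\<in>Field R. S = zigzag R `` {x} \<and> M = Restr R S)" (is "?L \<longleftrightarrow> ?R")
proof
  assume L: ?L
  then have c: "connected_subcategory (poset_cat R) S M" by (simp add: is_component_def)
  then obtain x where x: "x \<in> S" using connected_subcategory_poset_cat(1) by blast
  then have xF: "x \<in> Field R" using connected_subcategory_poset_cat(2)[OF c] by auto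
  define T where "T = zigzag R `` {x}"
  have "connected_subcategory (poset_cat R) T (Restr R T)"
    unfolding T_def by (rule zigzag_class_connected[OF R xF])
  moreover have "S \<subseteq> T" using connected_subcategory_poset_cat(4)[OF c x] by (simp add: T_def)
  moreover have "M \<subseteq> Restr R T"
    using connected_subcategory_poset_cat(3)[OF c] \<open>S \<subseteq> T\<close> by blast
  ultimately have "T = S \<and> Restr R T = M"
    using L unfolding is_component_def by blast
  then show ?R using xF by (auto simp: T_def)
next
  assume ?R
  then obtain x where x: "x \<in> Field R" and S: "S = zigzag R `` {x}" and M: "M = Restr R S"
    by blast
  show ?L
    unfolding is_component_def
  proof (intro conjI allI impI)
    show "connected_subcategory (poset_cat R) S M"
      using zigzag_class_connected[OF R x] by (simp add: S M)
    fix S' M' assume a: "connected_subcategory (poset_cat R) S' M' \<and> S \<subseteq> S' \<and> M \<subseteq> M'"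
    then have c: "connected_subcategory (poset_cat R) S' M'" by blast
    have "x \<in> S'" using a S by auto
    then show "S' = S" using connected_subcategory_poset_cat(4)[OF c] a S by blast
    then show "M' = M" using connected_subcategory_poset_cat(3)[OF c] a M by blast
  qed
qed

section \<open>Comma categories over an element of a poset\<close>

lemma fmor_poset:
  assumes "cat_functor C (poset_cat Q) F" and "f \<in> Mor C"
  shows "fmor F f = (fobj F (Dom C f), fobj F (Cod C f))" and "fmor F f \<in> Q"
proof -
  have "f \<in> hom C (Dom C f) (Cod C f)" using assms(2) by (simp add: hom_def)
  from cat_functor.fmor_in[OF assms(1) this]
  show "fmor F f = (fobj F (Dom C f), fobj F (Cod C f))" "fmor F f \<in> Q"
    by (auto simp: hom_poset_cat split: if_splits)
qed

definition objs_below :: "('o, 'm) cat \<Rightarrow> ('o, 'm, 'a, 'a \<times> 'a) ftor \<Rightarrow> 'a rel \<Rightarrow> 'a \<Rightarrow> 'o set" where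
  "objs_below C F Q d = {c \<in> Obj C. (fobj F c, d) \<in> Q}"

text \<open>An object of the comma category is determined by its first component, since a hom set of \<open>Q\<close>
  has at most one element; the commuting condition on its morphisms is vacuous.\<close>

lemma connected_comma_iff:
  assumes F: "cat_functor C (poset_cat Q) F"
  defines "B \<equiv> objs_below C F Q"
  shows "connected_category (comma C (poset_cat Q) F d) \<longleftrightarrow>
    B d \<noteq> {} \<and> (\<forall>c\<in>B d. \<forall>c'\<in>B d. (c, c') \<in> (Restr (linked C) (B d))\<^sup>*)"
proof -
  let ?K = "comma C (poset_cat Q) F d" and ?R = "Restr (linked C) (B d)"
  define j where "j c = (c, (fobj F c, d))" for c
  have Obj: "Obj ?K = j ` B d"
    by (auto simp: comma_def B_def objs_below_def j_def hom_poset_cat split: if_splits)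
  have hom: "hom ?K (j c) (j c') \<noteq> {} \<longleftrightarrow> hom C c c' \<noteq> {}" if "c \<in> B d" "c' \<in> B d" for c c'
  proof -
    have "fst (fmor F k) = fobj F c" if "k \<in> hom C c c'" for k
      using cat_functor.fmor_in[OF F that] by (auto simp: hom_poset_cat split: if_splits)
    then have "hom ?K (j c) (j c') = (\<lambda>k. (j c, k, j c')) ` hom C c c'"
      unfolding hom_def[of ?K] using that
      by (auto simp: comma_def j_def B_def objs_below_def hom_poset_cat image_iff)
    then show ?thesis by simp
  qed
  have linked: "(j c, j c') \<in> linked ?K \<longleftrightarrow> (c, c') \<in> ?R" for c c'
    using hom by (auto simp: linked_def Obj B_def objs_below_def j_def)
  have to_R: "(fst u, fst v) \<in> ?R\<^sup>*" if "(u, v) \<in> (linked ?K)\<^sup>*" for u v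
    using that
  proof (induction rule: rtrancl_induct)
    case (step v w)
    then obtain c c' where "v = j c" "w = j c'" by (auto simp: linked_def Obj)
    then have "(fst v, fst w) \<in> ?R" using step.hyps(2) linked by (simp add: j_def)
    with step.IH show ?case by (rule rtrancl_into_rtrancl)
  qed simp
  have from_R: "(j c, j c') \<in> (linked ?K)\<^sup>*" if "(c, c') \<in> ?R\<^sup>*" for c c'
    using that
  proof (induction rule: rtrancl_induct)
    case (step v w)
    then show ?case using linked by (meson rtrancl_into_rtrancl)
  qed simp
  have "(j c, j c') \<in> (linked ?K)\<^sup>* \<longleftrightarrow> (c, c') \<in> ?R\<^sup>*" for c c'
    using to_R[of "j c" "j c'"] from_R by (auto simp: j_def)
  then show ?thesis by (simp add: connected_category_def Obj)
qed

lemma cat_functor_inclusion: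
  assumes "Partial_order P" "Partial_order Q" "P \<subseteq> Q"
  shows "cat_functor (poset_cat P) (poset_cat Q) poset_inclusion"
proof -
  interpret C: category "poset_cat P" using category_poset_cat assms by blast
  interpret D: category "poset_cat Q" using category_poset_cat assms by blast
  show ?thesis
    using assms(3)
    by unfold_locales
      (auto simp: poset_inclusion_def hom_poset_cat Field_def split: if_splits)
qed

section \<open>Posets with finite downsets\<close>

locale downfinite_poset =
  fixes Q :: "'a rel"
  assumes PO: "Partial_order Q" and fin: "finite_downsets Q"
begin

lemma Q_refl: "x \<in> Field Q \<Longrightarrow> (x, x) \<in> Q"
  and Q_trans: "(x, y) \<in> Q \<Longrightarrow> (y, z) \<in> Q \<Longrightarrow> (x, z) \<in> Q"
  and Q_antisym: "(x, y) \<in> Q \<Longrightarrow> (y, x) \<in> Q \<Longrightarrow> x = y"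
  using PO by (auto simp: order_on_defs refl_on_def antisym_def dest: transD)

lemma wf_strict: "wf (Q - Id)"
proof (rule wf_subset[OF wf_measure])
  show "Q - Id \<subseteq> measure (\<lambda>q. card {p \<in> Field Q. (p, q) \<in> Q})"
  proof (rule subrelI)
    fix p q assume "(p, q) \<in> Q - Id"
    then have pq: "(p, q) \<in> Q" "p \<noteq> q" by auto
    then have F: "p \<in> Field Q" "q \<in> Field Q" by (auto simp: Field_def)
    have "{x \<in> Field Q. (x, p) \<in> Q} \<subset> {x \<in> Field Q. (x, q) \<in> Q}"
      using pq F Q_refl Q_trans Q_antisym by blast
    then show "(p, q) \<in> measure (\<lambda>q. card {p \<in> Field Q. (p, q) \<in> Q})"
      using fin F by (auto simp: finite_downsets_def intro: psubset_card_mono)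
  qed
qed

lemma minimum_below:
  assumes "x \<in> Field Q"
  obtains m where "is_minimum Q m" "(m, x) \<in> Q"
proof -
  have "x \<in> {y. (y, x) \<in> Q}" using assms Q_refl by simp
  from wfE_min[OF wf_strict this] obtain m
    where m: "(m, x) \<in> Q" and min: "\<And>y. (y, m) \<in> Q - Id \<Longrightarrow> (y, x) \<notin> Q" by auto
  have "is_minimum Q m"
    unfolding is_minimum_def
    using m min Q_trans by (auto simp: Field_def)
  with m that show thesis by blast
qed

lemma in_dn: "(x, y) \<in> dn Q q \<longleftrightarrow> (x, y) \<in> Q \<and> (y, q) \<in> Q \<and> y \<noteq> q"
  using Q_trans Q_antisym by (auto simp: dn_def Field_def)

lemma Field_dn: "Field (dn Q q) = {x. (x, q) \<in> Q \<and> x \<noteq> q}"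
proof -
  have "x \<in> Field (dn Q q)" if "(x, q) \<in> Q" "x \<noteq> q" for x
    using that Q_refl[of x] in_dn[of x x q] by (auto simp: Field_def)
  moreover have "(x, q) \<in> Q \<and> x \<noteq> q" if "x \<in> Field (dn Q q)" for x
    using that by (auto simp: Field_def dn_def)
  ultimately show ?thesis by auto
qed

lemma Partial_order_dn: "Partial_order (dn Q q)"
  unfolding order_on_defs refl_on_def antisym_def trans_def
  using Q_trans Q_antisym Q_refl
  by (auto simp: Field_dn in_dn FieldI1)

text \<open>The element \<open>p\<close> is isolated for \<open>zigzag (dn Q p)\<close>, which is reflexive everywhere. So its
  classes in the downset of \<open>p\<close> are the components of \<open>dn Q p\<close> together with the singleton of \<open>p\<close>,
  and statements about relations to \<open>p\<close> can cover the identity of \<open>p\<close> as well.\<close>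

lemma zigzag_dn_less:
  assumes "(x, y) \<in> zigzag (dn Q p)" and "(x, p) \<in> Q" and "x \<noteq> p"
  shows "(y, p) \<in> Q" and "y \<noteq> p"
  using zigzag_Field[OF assms(1)] assms(2,3) by (auto simp: Field_dn)

lemma scaffold_elements_iff:
  "q \<in> scaffold_elements Q \<longleftrightarrow> q \<in> Field Q \<and>
     ((\<forall>x. (x, q) \<in> Q \<longrightarrow> x = q) \<or>
      (\<exists>x y. (x, q) \<in> Q \<and> x \<noteq> q \<and> (y, q) \<in> Q \<and> y \<noteq> q \<and> (x, y) \<notin> zigzag (dn Q q)))"
  unfolding scaffold_elements_def connected_poset_cat by (auto simp: Field_dn)

lemma minimum_scaffold_element: "is_minimum Q m \<Longrightarrow> m \<in> scaffold_elements Q"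
  by (simp add: scaffold_elements_iff is_minimum_def)

lemma initial_scaffold_iff:
  "initial_scaffold Q P \<longleftrightarrow> Partial_order P \<and> P \<subseteq> Q \<and> Field P = scaffold_elements Q \<and>
     (\<forall>p\<in>scaffold_elements Q. \<forall>x. (x, p) \<in> Q \<and> x \<noteq> p \<longrightarrow>
        (\<exists>m. is_minimum Q m \<and> (\<forall>m'. (x, m') \<in> zigzag (dn Q p) \<and> (m', p) \<in> P \<longleftrightarrow> m' = m)))"
proof -
  have comp: "is_component (poset_cat (dn Q p)) S M \<longleftrightarrow>
      (\<exists>x. (x, p) \<in> Q \<and> x \<noteq> p \<and> S = zigzag (dn Q p) `` {x} \<and> M = Restr (dn Q p) S)" for p S M
    by (auto simp: component_iff_zigzag_class[OF Partial_order_dn] Field_dn)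
  have main: "(\<exists>m. {m' \<in> zigzag (dn Q p) `` {x}. (m', p) \<in> P \<and> m' \<noteq> p} = {m} \<and> is_minimum Q m) \<longleftrightarrow>
      (\<exists>m. is_minimum Q m \<and> (\<forall>m'. (x, m') \<in> zigzag (dn Q p) \<and> (m', p) \<in> P \<longleftrightarrow> m' = m))"
    if "(x, p) \<in> Q" "x \<noteq> p" for x p
    using zigzag_dn_less(2)[OF _ that] by (auto simp: set_eq_iff)
  have all: "(\<forall>S M. is_component (poset_cat (dn Q p)) S M \<longrightarrow> \<Phi> S) \<longleftrightarrow>
      (\<forall>x. (x, p) \<in> Q \<and> x \<noteq> p \<longrightarrow> \<Phi> (zigzag (dn Q p) `` {x}))" for p and \<Phi> :: "'a set \<Rightarrow> bool"
    unfolding comp by blast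
  have classes: "(\<forall>S M. is_component (poset_cat (dn Q p)) S M \<longrightarrow>
        (\<exists>m. {m' \<in> S. (m', p) \<in> P \<and> m' \<noteq> p} = {m} \<and> is_minimum Q m)) \<longleftrightarrow>
      (\<forall>x. (x, p) \<in> Q \<and> x \<noteq> p \<longrightarrow>
        (\<exists>m. is_minimum Q m \<and> (\<forall>m'. (x, m') \<in> zigzag (dn Q p) \<and> (m', p) \<in> P \<longleftrightarrow> m' = m)))"
    for p
    unfolding all by (intro all_cong1 imp_cong refl main) blast+
  have "Field P \<subseteq> Field Q" if "P \<subseteq> Q" using that by (rule mono_Field)
  moreover have "\<exists>S M. is_component (poset_cat (dn Q p)) S M \<and> m \<in> S"
    if "P \<subseteq> Q" "(m, p) \<in> P" "m \<noteq> p" for m p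
    using that unfolding comp by (metis Image_singleton_iff subsetD zigzag_refl)
  ultimately show ?thesis
    unfolding initial_scaffold_def subposet_def classes
    by (cases "P \<subseteq> Q \<and> Field P = scaffold_elements Q") auto
qed

section \<open>Scaffolds exist and are initial\<close>

lemma initial_scaffold_exists: "\<exists>P. initial_scaffold Q P"
proof -
  let ?Z = "\<lambda>p. zigzag (dn Q p)"
  \<comment> \<open>The choice depends only on the class of \<open>x\<close>, which makes it the same throughout a component.\<close>
  define pick where "pick p x = (SOME m. is_minimum Q m \<and> m \<in> ?Z p `` {x})" for p x
  have pick: "is_minimum Q (pick p x) \<and> (x, pick p x) \<in> ?Z p" if x: "(x, p) \<in> Q" "x \<noteq> p" for p x
  proof -
    have "x \<in> Field Q" using x by (auto simp: Field_def)
    then obtain m where m: "is_minimum Q m" "(m, x) \<in> Q" by (rule minimum_below)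
    then have "(x, m) \<in> ?Z p" using x by (intro zigzag_sym[OF zigzag_step]) (simp add: in_dn)
    with m have "\<exists>m. is_minimum Q m \<and> m \<in> ?Z p `` {x}" by auto
    from someI_ex[OF this] show ?thesis by (simp add: pick_def)
  qed
  have pick_cong: "pick p x = pick p y" if "(x, y) \<in> ?Z p" for p x y
  proof -
    have "?Z p `` {x} = ?Z p `` {y}"
      using that by (auto intro: zigzag_trans zigzag_sym)
    then show ?thesis by (simp add: pick_def)
  qed
  define P where "P = Id_on (scaffold_elements Q) \<union>
    {(pick p x, p) |p x. p \<in> scaffold_elements Q \<and> (x, p) \<in> Q \<and> x \<noteq> p}"
  have strict: "is_minimum Q m \<and> (m, p) \<in> Q \<and> p \<in> scaffold_elements Q \<and> m \<in> scaffold_elements Q"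
    if mp: "(m, p) \<in> P" "m \<noteq> p" for m p
  proof -
    obtain x where x: "m = pick p x" "p \<in> scaffold_elements Q" "(x, p) \<in> Q" "x \<noteq> p"
      using mp by (auto simp: P_def)
    with pick[of x p] zigzag_dn_less(1)[of x m p] minimum_scaffold_element show ?thesis by auto
  qed
  have mem: "m \<in> scaffold_elements Q \<and> p \<in> scaffold_elements Q \<and> (m, p) \<in> Q"
    if mp: "(m, p) \<in> P" for m p
  proof (cases "m = p")
    case True
    then have "p \<in> scaffold_elements Q" using mp by (auto simp: P_def)
    with True show ?thesis using Q_refl by (simp add: scaffold_elements_iff)
  next
    case False
    then show ?thesis using strict mp by blast
  qed
  have PQ: "P \<subseteq> Q" using mem by auto
  have refl: "(p, p) \<in> P" if "p \<in> scaffold_elements Q" for p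
    using that by (auto simp: P_def)
  have Field: "Field P = scaffold_elements Q"
    using refl mem unfolding Field_def by blast
  have "trans P"
  proof (rule transI)
    fix x y z assume a: "(x, y) \<in> P" "(y, z) \<in> P"
    \<comment> \<open>One of the two relations is an identity: the source of any other relation is minimal.\<close>
    show "(x, z) \<in> P"
    proof (cases "y = z")
      case False
      then have "x = y" using a strict[of y z] PQ by (auto simp: is_minimum_def)
      with a show ?thesis by simp
    qed (use a in simp)
  qed
  moreover have "antisym P" using PQ Q_antisym by (auto simp: antisym_def)
  ultimately have "Partial_order P"
    using refl Field by (auto simp: order_on_defs refl_on_def Field_def)
  moreover have "\<exists>m. is_minimum Q m \<and> (\<forall>m'. (x, m') \<in> ?Z p \<and> (m', p) \<in> P \<longleftrightarrow> m' = m)"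
    if p: "p \<in> scaffold_elements Q" and x: "(x, p) \<in> Q" "x \<noteq> p" for p x
  proof (intro exI[of _ "pick p x"] conjI allI iffI)
    show "is_minimum Q (pick p x)" using pick[OF x] by blast
    fix m'
    show "(x, m') \<in> ?Z p" "(m', p) \<in> P" if "m' = pick p x"
      using that pick[OF x] p x by (auto simp: P_def)
    assume m': "(x, m') \<in> ?Z p \<and> (m', p) \<in> P"
    then have "m' \<noteq> p" using zigzag_dn_less(2) x by blast
    then obtain y where y: "m' = pick p y" "(y, p) \<in> Q" "y \<noteq> p" using m' by (auto simp: P_def)
    then have "(y, m') \<in> ?Z p" using pick by blast
    then have "(y, x) \<in> ?Z p" using m' by (blast intro: zigzag_trans zigzag_sym)
    then show "m' = pick p x" using y pick_cong by metis
  qed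
  ultimately show ?thesis using initial_scaffold_iff PQ Field by blast
qed

text \<open>For \<open>a\<close> below \<open>q\<close> the scaffold elements below \<open>a\<close> are joined already below \<open>a\<close>, by
  induction; along a step of a zigzag in \<open>dn Q q\<close> the smaller of the two elements provides a scaffold
  element below both. Hence scaffold elements over one component of \<open>dn Q q\<close> are joined, and if \<open>q\<close> is
  itself a scaffold element each component is joined to \<open>q\<close> by a relation of \<open>P\<close>.\<close>

lemma scaffold_connected_below:
  assumes P: "initial_scaffold Q P"
    and "a \<in> scaffold_elements Q" "(a, q) \<in> Q" "b \<in> scaffold_elements Q" "(b, q) \<in> Q"
  shows "(a, b) \<in> zigzag (Restr P {p. (p, q) \<in> Q})"
  using wf_strict assms(2-)
proof (induction q arbitrary: a b)
  case (less q)
  let ?I = "scaffold_elements Q"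
  let ?W = "\<lambda>q. zigzag (Restr P {p. (p, q) \<in> Q})"
  have W_mono: "?W r \<subseteq> ?W q" if "(r, q) \<in> Q" for r
    by (rule zigzag_mono) (use that Q_trans in auto)
  have below: "(a, b) \<in> ?W q"
    if "a \<in> ?I" "(a, r) \<in> Q" "b \<in> ?I" "(b, r) \<in> Q" "(r, q) \<in> Q" "r \<noteq> q" for a b r
    using less.IH[of r a b] that W_mono by auto
  have along: "(a, b) \<in> ?W q"
    if xy: "(x, y) \<in> zigzag (dn Q q)" and x: "(x, q) \<in> Q" "x \<noteq> q"
      and ab: "a \<in> ?I" "(a, x) \<in> Q" "b \<in> ?I" "(b, y) \<in> Q" for x y a b
    using xy[unfolded zigzag_def] ab(3,4)
  proof (induction arbitrary: b rule: rtrancl_induct)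
    case base
    then show ?case using below x ab by blast
  next
    case (step y z)
    have y: "(y, q) \<in> Q" "y \<noteq> q" and z: "(z, q) \<in> Q" "z \<noteq> q"
      using step.hyps(2) Q_trans Q_antisym by (auto simp: in_dn)
    obtain w where w: "(w, y) \<in> Q" "(w, z) \<in> Q" "w \<in> Field Q"
      using step.hyps(2) Q_refl[of y] Q_refl[of z] by (auto simp: in_dn Field_def)
    obtain m where m: "is_minimum Q m" "(m, w) \<in> Q" using minimum_below w(3) by blast
    have "m \<in> ?I" using m minimum_scaffold_element by blast
    moreover have "(m, y) \<in> Q" "(m, z) \<in> Q" using m w Q_trans by blast+
    ultimately have "(a, m) \<in> ?W q" "(m, b) \<in> ?W q"
      using step.IH below step.prems z by blast+
    then show ?case by (rule zigzag_trans)
  qed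
  show ?case
  proof (cases "q \<in> ?I")
    case True
    have "(c, q) \<in> ?W q" if c: "c \<in> ?I" "(c, q) \<in> Q" for c
    proof (cases "c = q")
      case False
      obtain m where m: "is_minimum Q m" "(c, m) \<in> zigzag (dn Q q)" "(m, q) \<in> P"
        using P True c False unfolding initial_scaffold_iff by metis
      have mI: "m \<in> ?I" and mF: "m \<in> Field Q"
        using m(1) minimum_scaffold_element by (auto simp: is_minimum_def)
      have cc: "(c, c) \<in> Q" using c(2) Q_refl by (auto simp: Field_def)
      have "(c, m) \<in> ?W q" by (rule along[OF m(2) c(2) False c(1) cc mI Q_refl[OF mF]])
      moreover have "(m, q) \<in> ?W q"
        using m P True Q_refl by (intro zigzag_step) (auto simp: initial_scaffold_iff scaffold_elements_iff)
      ultimately show ?thesis by (rule zigzag_trans)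
    qed simp
    then show ?thesis using less.prems by (meson zigzag_trans zigzag_sym)
  next
    case False
    then have ne: "a \<noteq> q" "b \<noteq> q" using less.prems by auto
    have "q \<in> Field Q" using less.prems by (auto simp: Field_def)
    then have "(a, b) \<in> zigzag (dn Q q)"
      using False ne less.prems unfolding scaffold_elements_iff by blast
    moreover have "(a, a) \<in> Q" "(b, b) \<in> Q" using less.prems Q_refl by (auto simp: Field_def)
    ultimately show ?thesis using along less.prems ne by blast
  qed
qed

lemma scaffold_initial:
  assumes P: "initial_scaffold Q P"
  shows "initial_functor (poset_cat P) (poset_cat Q) poset_inclusion"
proof -
  have F: "cat_functor (poset_cat P) (poset_cat Q) poset_inclusion"
    using P PO cat_functor_inclusion by (auto simp: initial_scaffold_iff)
  have FP: "Field P = scaffold_elements Q" using P by (simp add: initial_scaffold_iff)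
  have B: "objs_below (poset_cat P) poset_inclusion Q d =
      {p \<in> scaffold_elements Q. (p, d) \<in> Q}" for d
    by (auto simp: objs_below_def poset_inclusion_def FP)
  have R: "Restr (linked (poset_cat P)) {p \<in> scaffold_elements Q. (p, d) \<in> Q} =
      Restr P {p. (p, d) \<in> Q} \<union> (Restr P {p. (p, d) \<in> Q})\<inverse>" for d
    using FP by (auto simp: linked_poset_cat Field_def)
  show ?thesis
    unfolding initial_functor_def connected_comma_iff[OF F] B R zigzag_def[symmetric]
    using F scaffold_connected_below[OF P] minimum_below minimum_scaffold_element
    by simp blast
qed

section \<open>Every initial functor covers a scaffold\<close>

lemma scaffold_unique:
  assumes P: "initial_scaffold Q P" and "(m, p) \<in> P" "(m', p) \<in> P" "(m, m') \<in> zigzag (dn Q p)"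
  shows "m = m'"
proof (cases "m = p")
  case True
  have "(m', p) \<in> Q" using P assms(3) by (auto simp: initial_scaffold_iff)
  then show ?thesis
    using True zigzag_sym[OF assms(4)] zigzag_dn_less(2)[of m' p p] by blast
next
  case False
  have "(m, p) \<in> Q" "p \<in> scaffold_elements Q"
    using P assms(2) by (auto simp: initial_scaffold_iff Field_def)
  then obtain m0 where "\<forall>m'. (m, m') \<in> zigzag (dn Q p) \<and> (m', p) \<in> P \<longleftrightarrow> m' = m0"
    using P False unfolding initial_scaffold_iff by metis
  then show ?thesis using assms(2-4) zigzag_refl by metis
qed

context
  fixes C :: "('o, 'm) cat" and F :: "('o, 'm, 'a, 'a \<times> 'a) ftor"
  assumes ini: "initial_functor C (poset_cat Q) F"
begin

lemma initial_cat_functor: "cat_functor C (poset_cat Q) F"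
  using ini by (simp add: initial_functor_def)

lemma initial_object_below:
  assumes "d \<in> Field Q"
  obtains c where "c \<in> Obj C" "(fobj F c, d) \<in> Q"
  using ini assms
  by (auto simp: initial_functor_def connected_comma_iff[OF initial_cat_functor] objs_below_def)

text \<open>The image of the first morphism with which a zigzag below \<open>p\<close> leaves the component of \<open>x\<close>
  relates the two endpoints in \<open>Q\<close> but not in \<open>dn Q p\<close>; so one endpoint is \<open>p\<close>, and it is the upper
  one.\<close>

lemma initial_leaves_component:
  assumes x: "(x, p) \<in> Q" "x \<noteq> p"
    and c: "c \<in> Obj C" "(fobj F c, p) \<in> Q" "(x, fobj F c) \<notin> zigzag (dn Q p)"
  shows "\<exists>f\<in>Mor C. \<exists>y. fmor F f = (y, p) \<and> (x, y) \<in> zigzag (dn Q p)"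
proof (rule ccontr)
  assume none: "\<not> ?thesis"
  let ?Z = "zigzag (dn Q p)" and ?B = "objs_below C F Q p"
  have xF: "x \<in> Field Q" and pF: "p \<in> Field Q" using x by (auto simp: Field_def)
  obtain c0 where c0: "c0 \<in> Obj C" "(fobj F c0, x) \<in> Q" using initial_object_below xF by blast
  have "(c0, c) \<in> (Restr (linked C) ?B)\<^sup>*"
    using ini pF c c0 Q_trans x
    unfolding initial_functor_def connected_comma_iff[OF initial_cat_functor]
    by (auto simp: objs_below_def)
  then have "(x, fobj F c) \<in> ?Z"
  proof (induction rule: rtrancl_induct)
    case base
    show ?case using c0 x by (intro zigzag_sym[OF zigzag_step]) (simp add: in_dn)
  next
    case (step c1 c2)
    have c1: "(fobj F c1, p) \<in> Q" "fobj F c1 \<noteq> p" using zigzag_dn_less step.IH x by blast+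
    have c2: "(fobj F c2, p) \<in> Q" using step.hyps(2) by (auto simp: objs_below_def)
    consider f where "f \<in> hom C c1 c2" | f where "f \<in> hom C c2 c1"
      using step.hyps(2) by (auto simp: linked_def)
    then have "(fobj F c1, fobj F c2) \<in> ?Z"
    proof cases
      case 1
      then have f: "f \<in> Mor C" "fmor F f = (fobj F c1, fobj F c2)" "(fobj F c1, fobj F c2) \<in> Q"
        using fmor_poset[OF initial_cat_functor, of f] by (auto simp: hom_def)
      then have "fobj F c2 \<noteq> p" using none step.IH by auto
      then show ?thesis using f c2 by (intro zigzag_step) (simp add: in_dn)
    next
      case 2
      then have "(fobj F c2, fobj F c1) \<in> Q"
        using fmor_poset[OF initial_cat_functor, of f] by (auto simp: hom_def)
      then show ?thesis using c1 by (intro zigzag_sym[OF zigzag_step]) (simp add: in_dn)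
    qed
    with step.IH show ?case by (rule zigzag_trans)
  qed
  with c show False by blast
qed

lemma initial_hits_scaffold_elements:
  assumes "p \<in> scaffold_elements Q"
  obtains c where "c \<in> Obj C" "fobj F c = p"
proof -
  have pF: "p \<in> Field Q" using assms by (simp add: scaffold_elements_iff)
  consider "\<And>x. (x, p) \<in> Q \<Longrightarrow> x = p"
    | x y where "(x, p) \<in> Q" "x \<noteq> p" "(y, p) \<in> Q" "y \<noteq> p" "(x, y) \<notin> zigzag (dn Q p)"
    using assms unfolding scaffold_elements_iff by blast
  then show thesis
  proof cases
    case 1
    then show thesis using initial_object_below[OF pF] that by blast
  next
    case (2 x y)
    obtain c where c: "c \<in> Obj C" "(fobj F c, y) \<in> Q"
      using initial_object_below[of y] 2 by (auto simp: Field_def)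
    have "(fobj F c, y) \<in> zigzag (dn Q p)" using c 2 by (intro zigzag_step) (simp add: in_dn)
    then have "(x, fobj F c) \<notin> zigzag (dn Q p)" using 2(5) zigzag_trans by metis
    then obtain f z where f: "f \<in> Mor C" "fmor F f = (z, p)"
      using initial_leaves_component[of x p c] 2 c Q_trans by blast
    have "category C" using initial_cat_functor by (simp add: cat_functor_def)
    then have "Cod C f \<in> Obj C" using f by (simp add: category.Cod_in)
    moreover have "fobj F (Cod C f) = p" using fmor_poset(1)[OF initial_cat_functor f(1)] f by simp
    ultimately show thesis using that by blast
  qed
qed

lemma initial_lifts_relation:
  assumes p: "p \<in> scaffold_elements Q" and x: "(x, p) \<in> Q"
  shows "\<exists>f\<in>Mor C. \<exists>y. fmor F f = (y, p) \<and> (x, y) \<in> zigzag (dn Q p)"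
proof -
  obtain c where c: "c \<in> Obj C" "fobj F c = p" using initial_hits_scaffold_elements[OF p] by blast
  show ?thesis
  proof (cases "x = p")
    case True
    have "category C" using initial_cat_functor by (simp add: cat_functor_def)
    then have f: "Ident C c \<in> hom C c c" using c by (simp add: category.Ident_in)
    then have "fmor F (Ident C c) = (p, p)"
      using fmor_poset(1)[OF initial_cat_functor, of "Ident C c"] c by (simp add: hom_def)
    moreover have "Ident C c \<in> Mor C" using f by (simp add: hom_def)
    ultimately show ?thesis using True by (intro bexI[of _ "Ident C c"]) auto
  next
    case False
    have "(x, p) \<notin> zigzag (dn Q p)" using zigzag_dn_less(2)[OF _ x False] by blast
    moreover have "(p, p) \<in> Q" using p Q_refl by (simp add: scaffold_elements_iff)
    ultimately show ?thesis using initial_leaves_component[OF x False c(1)] c by simp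
  qed
qed

text \<open>The relation lifted from \<open>(m, p)\<close> need not be \<open>(m, p)\<close> itself, but it starts in the class of
  \<open>m\<close>, and a scaffold has only one relation to \<open>p\<close> from each class; so even the images of the lifts
  are distinct.\<close>

lemma scaffold_lift:
  assumes P: "initial_scaffold Q P"
  obtains h where "h ` P \<subseteq> Mor C" and "inj_on (fmor F \<circ> h) P"
    and "\<And>m p. (m, p) \<in> P \<Longrightarrow> \<exists>y. fmor F (h (m, p)) = (y, p) \<and> (m, y) \<in> zigzag (dn Q p)"
proof -
  have "\<forall>r\<in>P. \<exists>f. f \<in> Mor C \<and> (\<exists>y. fmor F f = (y, snd r) \<and> (fst r, y) \<in> zigzag (dn Q (snd r)))"
  proof clarify
    fix m p assume "(m, p) \<in> P"
    then have "p \<in> scaffold_elements Q" "(m, p) \<in> Q"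
      using P by (auto simp: initial_scaffold_iff Field_def)
    from initial_lifts_relation[OF this]
    show "\<exists>f. f \<in> Mor C \<and> (\<exists>y. fmor F f = (y, snd (m, p)) \<and> (fst (m, p), y) \<in> zigzag (dn Q (snd (m, p))))"
      by auto
  qed
  from bchoice[OF this] obtain h where h: "\<And>m p. (m, p) \<in> P \<Longrightarrow> h (m, p) \<in> Mor C"
      "\<And>m p. (m, p) \<in> P \<Longrightarrow> \<exists>y. fmor F (h (m, p)) = (y, p) \<and> (m, y) \<in> zigzag (dn Q p)"
    by fastforce
  have "inj_on (fmor F \<circ> h) P"
  proof (rule inj_onI, clarify)
    fix m p m' p' assume a: "(m, p) \<in> P" "(m', p') \<in> P"
      and eq: "(fmor F \<circ> h) (m, p) = (fmor F \<circ> h) (m', p')"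
    obtain y where "p' = p" "(m, y) \<in> zigzag (dn Q p)" "(m', y) \<in> zigzag (dn Q p)"
      using h(2)[OF a(1)] h(2)[OF a(2)] eq by auto
    moreover from this have "(m, m') \<in> zigzag (dn Q p)" by (meson zigzag_trans zigzag_sym)
    ultimately show "m = m' \<and> p = p'" using scaffold_unique[OF P a(1)] a(2) by simp
  qed
  moreover have "h ` P \<subseteq> Mor C" using h(1) by auto
  ultimately show thesis using that h(2) by blast
qed

lemma scaffold_lepoll:
  assumes P: "initial_scaffold Q P"
  shows "Field P \<lesssim> Obj C" and "P \<lesssim> Mor C"
proof -
  have "Field P \<subseteq> fobj F ` Obj C"
    using P initial_hits_scaffold_elements by (auto simp: initial_scaffold_iff)
  then show "Field P \<lesssim> Obj C"
    by (meson image_lepoll lepoll_trans subset_imp_lepoll)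
  obtain h where "h ` P \<subseteq> Mor C" "inj_on (fmor F \<circ> h) P"
    using scaffold_lift[OF P] by metis
  then show "P \<lesssim> Mor C" unfolding lepoll_def using inj_on_imageI2 by blast
qed

end

lemma scaffold_minimal_initial:
  assumes "initial_scaffold Q P"
  shows "minimal_initial_functor TYPE('x) TYPE('y) (poset_cat P) (poset_cat Q) poset_inclusion"
  unfolding minimal_initial_functor_def
  using scaffold_initial[OF assms] scaffold_lepoll[OF _ assms] by auto

section \<open>Minimal initial functors when a finite scaffold exists\<close>

text \<open>Counting makes \<open>F\<close> injective on objects and on morphisms. The first of these makes the image
  closed under composition, since morphisms with composable images are then composable; this gives
  transitivity of the image and the minimality of the sources of its relations.\<close>

lemma minimal_initial_image_scaffold:
  assumes P: "initial_scaffold Q P" and fin_P: "finite (Field P)"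
    and ini: "initial_functor C (poset_cat Q) F"
    and size: "Obj C \<lesssim> Field P" "Mor C \<lesssim> P"
  shows "embedding C (poset_cat Q) F"
    and "\<exists>P'. initial_scaffold Q P' \<and> functor_image C F = (Field P', P')"
proof -
  let ?I = "scaffold_elements Q" and ?Z = "\<lambda>p. zigzag (dn Q p)"
  note F = initial_cat_functor[OF ini]
  interpret cat_functor C "poset_cat Q" F by (rule F)
  note fm = fmor_poset[OF F]
  have FP: "Field P = ?I" and PQ: "P \<subseteq> Q" using P by (auto simp: initial_scaffold_iff)
  have "P \<subseteq> Field P \<times> Field P" by (auto simp: Field_def)
  then have finP: "finite P" using fin_P finite_subset by blast
  have fO: "finite (Obj C)" and fM: "finite (Mor C)"
    using size fin_P finP by (meson inj_on_finite lepoll_def)+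
  have cO: "card (Obj C) \<le> card ?I" and cM: "card (Mor C) \<le> card P"
    using size fin_P finP fO fM FP by (auto simp: lepoll_iff_card_le)
  have sub: "?I \<subseteq> fobj F ` Obj C" using initial_hits_scaffold_elements[OF ini] by blast
  then have "card ?I \<le> card (fobj F ` Obj C)" using fO by (simp add: card_mono)
  moreover have "card (fobj F ` Obj C) \<le> card (Obj C)" using fO by (rule card_image_le)
  ultimately have eqs: "card (fobj F ` Obj C) = card (Obj C)" "card ?I = card (fobj F ` Obj C)"
    using cO by linarith+
  have injO: "inj_on (fobj F) (Obj C)" using fO eqs(1) by (rule eq_card_imp_inj_on)
  have imO: "fobj F ` Obj C = ?I" using card_subset_eq[OF _ sub eqs(2)] fO by simp
  obtain h where h: "h ` P \<subseteq> Mor C" "inj_on (fmor F \<circ> h) P"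
    and hz: "\<And>m p. (m, p) \<in> P \<Longrightarrow> \<exists>y. fmor F (h (m, p)) = (y, p) \<and> (m, y) \<in> ?Z p"
    using scaffold_lift[OF ini P] by metis
  have "card (h ` P) = card P" by (rule card_image[OF inj_on_imageI2[OF h(2)]])
  then have hP: "h ` P = Mor C"
    using card_mono[OF fM h(1)] cM h(1) fM by (intro card_subset_eq) auto
  have injM: "inj_on (fmor F) (Mor C)" using inj_on_imageI[OF h(2)] hP by simp
  show "embedding C (poset_cat Q) F"
    using F injO injM by (auto simp: embedding_def faithful_def hom_def inj_on_def)
  define P' where "P' = fmor F ` Mor C"
  have P'Q: "P' \<subseteq> Q" using fm(2) by (auto simp: P'_def)
  have refl: "(p, p) \<in> P'" if p: "p \<in> ?I" for p
  proof -
    obtain c where c: "c \<in> Obj C" "fobj F c = p" using p sub by auto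
    then have m: "Ident C c \<in> Mor C" "Dom C (Ident C c) = c" "Cod C (Ident C c) = c"
      using C.Ident_in[of c] by (simp_all add: hom_def)
    then have "fmor F (Ident C c) = (p, p)" using fm(1)[OF m(1)] c by simp
    then show ?thesis using m(1) unfolding P'_def by (metis imageI)
  qed
  have P'I: "a \<in> ?I \<and> b \<in> ?I" if ab: "(a, b) \<in> P'" for a b
  proof -
    obtain f where "f \<in> Mor C" "fmor F f = (a, b)" using ab by (auto simp: P'_def)
    then have "a = fobj F (Dom C f)" "b = fobj F (Cod C f)" "Dom C f \<in> Obj C" "Cod C f \<in> Obj C"
      using fm(1)[of f] C.Dom_in C.Cod_in by auto
    then show ?thesis unfolding imO[symmetric] by simp
  qed
  have Field: "Field P' = ?I" using refl P'I by (auto simp: Field_def)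
  have trans: "(a, c) \<in> P'" if bc: "(a, b) \<in> P'" "(b, c) \<in> P'" for a b c
  proof -
    obtain f g where f: "f \<in> Mor C" "fmor F f = (a, b)" and g: "g \<in> Mor C" "fmor F g = (b, c)"
      using bc by (auto simp: P'_def)
    then have "fobj F (Cod C f) = fobj F (Dom C g)" using fm(1) by simp
    then have "Cod C f = Dom C g" using injO f g C.Cod_in C.Dom_in by (meson inj_onD)
    then have "Comp C g f \<in> hom C (Dom C f) (Cod C g)"
      using f g by (intro C.Comp_in[of _ _ "Dom C g"]) (auto simp: hom_def)
    then have m: "Comp C g f \<in> Mor C" "Dom C (Comp C g f) = Dom C f" "Cod C (Comp C g f) = Cod C g"
      by (auto simp: hom_def)
    then have "fmor F (Comp C g f) = (a, c)" using fm(1)[OF m(1)] fm(1)[OF f(1)] fm(1)[OF g(1)] f g by simp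
    then show ?thesis using m(1) unfolding P'_def by (metis imageI)
  qed
  have ex: "\<exists>y. (y, p) \<in> P' \<and> (x, y) \<in> ?Z p" if px: "p \<in> ?I" "(x, p) \<in> Q" for p x
  proof -
    obtain f y where f: "f \<in> Mor C" "fmor F f = (y, p)" "(x, y) \<in> ?Z p"
      using initial_lifts_relation[OF ini px] by blast
    then have "(y, p) \<in> P'" unfolding P'_def by (metis imageI)
    then show ?thesis using f(3) by blast
  qed
  have uniq: "y = y'" if y: "(y, p) \<in> P'" "(y', p) \<in> P'" "(y, y') \<in> ?Z p" for y y' p
  proof -
    have lift: "\<exists>m. (m, p) \<in> P \<and> fmor F (h (m, p)) = (z, p) \<and> (m, z) \<in> ?Z p"
      if z: "(z, p) \<in> P'" for z
    proof -
      obtain m p0 where m: "(m, p0) \<in> P" "fmor F (h (m, p0)) = (z, p)"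
        using z unfolding P'_def hP[symmetric] by auto
      then show ?thesis using hz[OF m(1)] by auto
    qed
    obtain m m' where m: "(m, p) \<in> P" "fmor F (h (m, p)) = (y, p)" "(m, y) \<in> ?Z p"
      and m': "(m', p) \<in> P" "fmor F (h (m', p)) = (y', p)" "(m', y') \<in> ?Z p"
      using lift y(1,2) by blast
    have "(m, m') \<in> ?Z p" using m(3) m'(3) y(3) by (meson zigzag_trans zigzag_sym)
    then have "m = m'" using scaffold_unique[OF P m(1) m'(1)] by blast
    with m m' show ?thesis by simp
  qed
  \<comment> \<open>A relation \<open>y < x\<close> in the image composes to a relation \<open>y < p\<close> from the class of \<open>x\<close>.\<close>
  have min: "is_minimum Q x" if xp: "(x, p) \<in> P'" "x \<noteq> p" for x p
  proof (rule ccontr)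
    assume "\<not> is_minimum Q x"
    moreover have x: "x \<in> ?I" "p \<in> ?I" "(x, p) \<in> Q" using P'I P'Q xp by auto
    ultimately obtain w where w: "(w, x) \<in> Q" "w \<noteq> x"
      by (auto simp: is_minimum_def scaffold_elements_iff)
    then obtain y where y: "(y, x) \<in> P'" "(w, y) \<in> ?Z x" using ex x by blast
    then have yx: "y \<noteq> x" "(y, x) \<in> Q" using zigzag_dn_less w by blast+
    have "(y, p) \<in> P'" using trans y xp by blast
    moreover have "(y, x) \<in> ?Z p" using yx x xp by (intro zigzag_step) (simp add: in_dn)
    ultimately show False using uniq xp yx by blast
  qed
  have "Refl P'" using refl Field by (simp add: refl_on_def)
  moreover have "P' \<subseteq> Field P' \<times> Field P'" by (auto simp: Field_def)
  moreover have "Relation.trans P'" using trans by (rule transI)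
  moreover have "antisym P'" using P'Q Q_antisym by (meson antisymI subsetD)
  ultimately have "Partial_order P'" by (simp add: order_on_defs)
  moreover have "\<exists>m. is_minimum Q m \<and> (\<forall>m'. (x, m') \<in> ?Z p \<and> (m', p) \<in> P' \<longleftrightarrow> m' = m)"
    if px: "p \<in> ?I" "(x, p) \<in> Q" "x \<noteq> p" for p x
  proof -
    obtain y where y: "(y, p) \<in> P'" "(x, y) \<in> ?Z p" using ex px by blast
    then have "y \<noteq> p" using zigzag_dn_less px by blast
    then have "is_minimum Q y" using min y by blast
    moreover have "m' = y" if "(x, m') \<in> ?Z p" "(m', p) \<in> P'" for m'
      using uniq[OF that(2) y(1)] that y by (meson zigzag_trans zigzag_sym)
    ultimately show ?thesis using y by blast
  qed
  ultimately have "initial_scaffold Q P'" using P'Q Field by (simp add: initial_scaffold_iff)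
  moreover have "functor_image C F = (Field P', P')"
    by (simp add: functor_image_def imO Field P'_def[symmetric])
  ultimately show "\<exists>P'. initial_scaffold Q P' \<and> functor_image C F = (Field P', P')" by blast
qed

end

theorem theorem3p5:
  fixes Q :: "'a rel"
  assumes "Partial_order Q" and "finite_downsets Q"
  shows
    "(\<exists>P. initial_scaffold Q P) \<and>
     (\<forall>P. initial_scaffold Q P \<longrightarrow>
        minimal_initial_functor TYPE('x) TYPE('y) (poset_cat P) (poset_cat Q) poset_inclusion) \<and>
     ((\<exists>P. initial_scaffold Q P \<and> finite (Field P)) \<longrightarrow>
        (\<forall>(C :: ('c, 'm) cat) F.
           minimal_initial_functor TYPE('a) TYPE('a \<times> 'a) C (poset_cat Q) F \<longrightarrow>
             embedding C (poset_cat Q) F \<and>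
             (\<exists>P. initial_scaffold Q P \<and> functor_image C F = (Field P, P))))"
proof -
  interpret downfinite_poset Q using assms by unfold_locales
  have "embedding C (poset_cat Q) F \<and>
      (\<exists>P. initial_scaffold Q P \<and> functor_image C F = (Field P, P))"
    if P: "initial_scaffold Q P" "finite (Field P)"
      and min: "minimal_initial_functor TYPE('a) TYPE('a \<times> 'a) C (poset_cat Q) F"
    for P and C :: "('c, 'm) cat" and F
  proof -
    have ini: "initial_functor C (poset_cat Q) F"
      using min by (simp add: minimal_initial_functor_def)
    have "Obj C \<lesssim> Obj (poset_cat P)" "Mor C \<lesssim> Mor (poset_cat P)"
      using min scaffold_initial[OF P(1)] unfolding minimal_initial_functor_def by blast+
    then have "Obj C \<lesssim> Field P" "Mor C \<lesssim> P" by simp_all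
    from minimal_initial_image_scaffold[OF P ini this] show ?thesis by blast
  qed
  then show ?thesis
    using initial_scaffold_exists scaffold_minimal_initial by blast
qed

end
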